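(* Let $t,h$ be positive integers with $h \leq 2t+1$, and let $G=C_3^tC_6^h$. Then $G$ is graceful or near graceful.
   Context: $C_n^t$ denotes the union of $t$ cycles of length $n$ sharing exactly one common (central) vertex, and $C_3^tC_6^h$ denotes the graph obtained by identifying the central vertices of $C_3^t$ and $C_6^h$. For a graph $G$ with $m$ edges, a graceful labelling is an injective map $f:V(G)\to\{0,\ldots,m\}$ such that $g(uv)=|f(u)-f(v)|$ is a bijection $E(G)\to\{1,\ldots,m\}$. A near graceful labelling is an injective map $f:V(G)\to\{0,\ldots,m+1\}$ such that $g(uv)=|f(u)-f(v)|$ is a bijection onto $\{1,\ldots,m-1,m\}$ or onto $\{1,\ldots,m-1,m+1\}$. *)

theory Defs
  imports Main
begin

type_synonym 'a graph = "'a set \<times> 'a set set"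

abbreviation verts :: "'a graph \<Rightarrow> 'a set" where "verts \<equiv> fst"
abbreviation edges :: "'a graph \<Rightarrow> 'a set set" where "edges \<equiv> snd"

definition simple_graph :: "'a graph \<Rightarrow> bool" where
  "simple_graph G \<longleftrightarrow> finite (verts G) \<and> (\<forall>e\<in>edges G. e \<subseteq> verts G \<and> card e = 2)"

text \<open>The label of an edge \<open>uv\<close> is \<open>\<bar>f u - f v\<bar>\<close>; as edges are unordered pairs, the edge
  labelling induced by \<open>f\<close> is described by its values on the sets \<open>{u, v}\<close>.\<close>

definition induced_edge_labelling :: "'a graph \<Rightarrow> ('a \<Rightarrow> int) \<Rightarrow> ('a set \<Rightarrow> int) \<Rightarrow> bool" where
  "induced_edge_labelling G f g \<longleftrightarrow>
     (\<forall>u v. {u, v} \<in> edges G \<longrightarrow> g {u, v} = \<bar>f u - f v\<bar>)"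

definition graceful_labelling :: "'a graph \<Rightarrow> ('a \<Rightarrow> int) \<Rightarrow> bool" where
  "graceful_labelling G f \<longleftrightarrow>
     (let m = int (card (edges G)) in
        inj_on f (verts G) \<and> f ` verts G \<subseteq> {0..m} \<and>
        (\<exists>g. induced_edge_labelling G f g \<and> bij_betw g (edges G) {1..m}))"

definition near_graceful_labelling :: "'a graph \<Rightarrow> ('a \<Rightarrow> int) \<Rightarrow> bool" where
  "near_graceful_labelling G f \<longleftrightarrow>
     (let m = int (card (edges G)) in
        inj_on f (verts G) \<and> f ` verts G \<subseteq> {0..m + 1} \<and>
        (\<exists>g. induced_edge_labelling G f g \<and>
             (bij_betw g (edges G) ({1..m - 1} \<union> {m}) \<or>
              bij_betw g (edges G) ({1..m - 1} \<union> {m + 1}))))"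

definition graceful :: "'a graph \<Rightarrow> bool" where
  "graceful G \<longleftrightarrow> (\<exists>f. graceful_labelling G f)"

definition near_graceful :: "'a graph \<Rightarrow> bool" where
  "near_graceful G \<longleftrightarrow> (\<exists>f. near_graceful_labelling G f)"

text \<open>Graphs with a distinguished central vertex live on an option type, the centre being
  \<open>None\<close>. In \<open>cycles_at_centre n t\<close> (the graph \<open>C\<^sub>n\<^sup>t\<close>, meant for \<open>n \<ge> 3\<close>) the \<open>i\<close>-th cycle,
  \<open>i < t\<close>, runs through \<open>cycle_vertex i 0, \<dots>, cycle_vertex i (n - 1)\<close>, and position \<open>0\<close> is
  the centre for every \<open>i\<close>.\<close>

definition cycle_vertex :: "nat \<Rightarrow> nat \<Rightarrow> (nat \<times> nat) option" where
  "cycle_vertex i j = (if j = 0 then None else Some (i, j))"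

definition cycles_at_centre :: "nat \<Rightarrow> nat \<Rightarrow> (nat \<times> nat) option graph" where
  "cycles_at_centre n t =
     ({cycle_vertex i j | i j. i < t \<and> j < n},
      {{cycle_vertex i j, cycle_vertex i ((j + 1) mod n)} | i j. i < t \<and> j < n})"

text \<open>Disjoint union with the two centres identified: \<open>map_option\<close> fixes \<open>None\<close>.\<close>

definition identify_centres :: "'a option graph \<Rightarrow> 'b option graph \<Rightarrow> ('a + 'b) option graph" where
  "identify_centres G H =
     (map_option Inl ` verts G \<union> map_option Inr ` verts H,
      (`) (map_option Inl) ` edges G \<union> (`) (map_option Inr) ` edges H)"

definition C3_C6 :: "nat \<Rightarrow> nat \<Rightarrow> (nat \<times> nat + nat \<times> nat) option graph" where
  "C3_C6 t h = identify_centres (cycles_at_centre 3 t) (cycles_at_centre 6 h)"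

lemma finite_edges: "simple_graph G \<Longrightarrow> finite (edges G)"
  by (rule finite_subset[of _ "Pow (verts G)"]) (auto simp: simple_graph_def)

lemma cycle_vertex_inject:
  "cycle_vertex i j = cycle_vertex i' j' \<longleftrightarrow> j = j' \<and> (j = 0 \<or> i = i')"
  by (auto simp: cycle_vertex_def)

lemma simple_graph_cycles_at_centre:
  assumes "n \<ge> 3"
  shows "simple_graph (cycles_at_centre n t)"
proof -
  let ?V = "{cycle_vertex i j | i j. i < t \<and> j < n}"
  have "?V = (\<lambda>(i, j). cycle_vertex i j) ` ({..<t} \<times> {..<n})"
    by auto
  then have "finite ?V" by simp
  moreover have "{cycle_vertex i j, cycle_vertex i ((j + 1) mod n)} \<subseteq> ?V" if "i < t" "j < n" for i j
    using that by force
  moreover have "card {cycle_vertex i j, cycle_vertex i ((j + 1) mod n)} = 2" if "j < n" for i j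
  proof -
    have "j \<noteq> (j + 1) mod n"
      using assms that by (cases "Suc j = n") auto
    then show ?thesis by (simp add: cycle_vertex_inject)
  qed
  ultimately show ?thesis
    unfolding simple_graph_def cycles_at_centre_def fst_conv snd_conv by blast
qed

lemma card_edges_cycles_at_centre:
  assumes "n \<ge> 3"
  shows "card (edges (cycles_at_centre n t)) = n * t"
proof -
  let ?e = "\<lambda>(i, j). {cycle_vertex i j, cycle_vertex i ((j + 1) mod n)}"
  have mod: "Suc j mod n = (if Suc j = n then 0 else Suc j)" if "j < n" for j
    using that by auto
  have "i = i' \<and> j = j'" if "j < n" "j' < n"
    "{cycle_vertex i j, cycle_vertex i ((j + 1) mod n)} =
     {cycle_vertex i' j', cycle_vertex i' ((j' + 1) mod n)}" for i i' j j'
    using assms that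
    by (simp add: doubleton_eq_iff cycle_vertex_inject mod split: if_splits) linarith+
  then have "inj_on ?e ({..<t} \<times> {..<n})"
    by (simp add: inj_on_def)
  moreover have "edges (cycles_at_centre n t) = ?e ` ({..<t} \<times> {..<n})"
    by (auto simp: cycles_at_centre_def)
  ultimately show ?thesis
    by (simp add: card_image mult.commute)
qed

lemma simple_graph_identify_centres:
  assumes "simple_graph G" "simple_graph H"
  shows "simple_graph (identify_centres G H)"
proof -
  have "inj (map_option (Inl :: 'a \<Rightarrow> 'a + 'b))" "inj (map_option (Inr :: 'b \<Rightarrow> 'a + 'b))"
    by (simp_all add: option.inj_map)
  then show ?thesis
    using assms unfolding simple_graph_def identify_centres_def fst_conv snd_conv
    by (auto simp: card_image inj_on_subset) (meson imageI subsetD)+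
qed

lemma card_edges_identify_centres:
  assumes "simple_graph G" "simple_graph H"
  shows "card (edges (identify_centres G H)) = card (edges G) + card (edges H)"
proof -
  let ?l = "map_option (Inl :: 'a \<Rightarrow> 'a + 'b)" and ?r = "map_option (Inr :: 'b \<Rightarrow> 'a + 'b)"
  have "inj ?l" "inj ?r"
    by (simp_all add: option.inj_map)
  then have inj: "inj ((`) ?l)" "inj ((`) ?r)"
    by (simp_all add: inj_image_eq_iff inj_def)
  have "?l ` e \<noteq> ?r ` e'" if e: "e \<in> edges G" for e e'
  proof
    assume eq: "?l ` e = ?r ` e'"
    have "x = None" if "x \<in> e" for x
    proof -
      have "?l x \<in> ?r ` e'"
        using eq that by blast
      then show ?thesis
        by (cases x) (auto simp: map_option_case split: option.splits)
    qed
    then have "e \<subseteq> {None}" by blast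
    then have "card e \<le> 1" using card_mono[of "{None}" e] by simp
    then show False using assms(1) e by (simp add: simple_graph_def)
  qed
  then have "((`) ?l ` edges G) \<inter> ((`) ?r ` edges H) = {}"
    by blast
  then have "card (edges (identify_centres G H)) = card ((`) ?l ` edges G) + card ((`) ?r ` edges H)"
    unfolding identify_centres_def snd_conv
    by (intro card_Un_disjoint finite_imageI finite_edges assms)
  also have "\<dots> = card (edges G) + card (edges H)"
    using inj by (simp add: card_image inj_on_subset)
  finally show ?thesis .
qed

lemma simple_graph_C3_C6: "simple_graph (C3_C6 t h)"
  by (simp add: C3_C6_def simple_graph_identify_centres simple_graph_cycles_at_centre)

lemma card_edges_C3_C6: "card (edges (C3_C6 t h)) = 3 * t + 6 * h"
  by (simp add: C3_C6_def card_edges_identify_centres simple_graph_cycles_at_centre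
      card_edges_cycles_at_centre)

end

theory Submission
  imports Defs
begin

text \<open>Put \<open>n = t + 2h\<close>, so that the graph has \<open>3n\<close> edges. A Skolem sequence of order \<open>n\<close> (hooked
  if \<open>n \<equiv> 2, 3\<close> modulo \<open>4\<close>) partitions \<open>{1..3n}\<close>, respectively \<open>{1..3n - 1} \<union> {3n + 1}\<close>, into
  triples \<open>d, x, d + x\<close> with \<open>d = 1, \<dots>, n\<close>. Label the centre \<open>0\<close>. One triple labels the edges of
  the triangle \<open>0, d, d + x\<close>; two triples \<open>d, x, d + x\<close> and \<open>e, y, e + y\<close> label the edges of the
  hexagon \<open>0, d + x, d, d + e, e, e + y\<close>. The vertex labels are distinct as soon as the sums
  \<open>d + e\<close> are distinct and each is the middle element of some triple. Skolem sequences whose first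
  half consists of left endpoints supply the middle elements \<open>n + 1, \<dots>, n + \<lceil>n/2\<rceil>\<close>, and
  \<open>h \<le> 2t + 1\<close> is what is needed to find \<open>h\<close> disjoint pairs in \<open>{1..n}\<close> whose sums are distinct
  members of this interval.\<close>

section \<open>Skolem sequences beginning with left endpoints\<close>

text \<open>The two occurrences of \<open>d\<close> in the sequence are at positions \<open>b d\<close> and \<open>b d + d\<close>. Only
  surjectivity onto the set \<open>V\<close> of positions is required: if \<open>card V = 2 * n\<close>, the positions
  are then distinct by counting.\<close>

definition skolem_starts :: "nat \<Rightarrow> nat set \<Rightarrow> (nat \<Rightarrow> nat) \<Rightarrow> bool" where
  "skolem_starts n V b \<longleftrightarrow>
     V \<subseteq> b ` {1..n} \<union> (\<lambda>d. b d + d) ` {1..n} \<and> {1..(n + 1) div 2} \<subseteq> b ` {1..n}"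

text \<open>A left endpoint also covers its own position, so in the first half a single witness
  serves both inclusions of the definition.\<close>

lemma skolem_startsI:
  assumes "\<And>v. 1 \<le> v \<Longrightarrow> v \<le> (n + 1) div 2 \<Longrightarrow> \<exists>d\<in>{1..n}. v = b d"
    and "\<And>v. v \<in> V \<Longrightarrow> (n + 1) div 2 < v \<Longrightarrow> \<exists>d\<in>{1..n}. v = b d \<or> v = b d + d"
    and "0 \<notin> V"
  shows "skolem_starts n V b"
proof -
  have "v \<in> b ` {1..n} \<union> (\<lambda>d. b d + d) ` {1..n}" if "v \<in> V" for v
  proof (cases "v \<le> (n + 1) div 2")
    case True
    moreover have "1 \<le> v"
      using that assms(3) by (cases v) auto
    ultimately show ?thesis using assms(1) by blast
  next
    case False
    then show ?thesis using assms(2)[OF that] by force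
  qed
  then show ?thesis
    using assms(1) unfolding skolem_starts_def by (auto simp: image_iff)
qed

section \<open>Explicit sequences for the residue classes of the order modulo 4\<close>

lemma skolem_starts_4s_minus_1:
  assumes "s \<ge> 2"
  shows "\<exists>b. skolem_starts (4 * s - 1) ({1..8 * s - 3} \<union> {8 * s - 1}) b"
proof -
  \<comment> \<open>The even differences are nested around \<open>2 * s\<close> and fill
    \<open>{1..4 * s - 1}\<close> except for this centre, where \<open>4 * s - 1\<close> starts. The
    remaining odd differences above and below \<open>2 * s - 1\<close> form two families nested near
    \<open>6 * s\<close>, the small ones inside the large ones. Finally \<open>1\<close> fills a gap
    between the families, and \<open>2 * s - 1\<close> ends at the hook
    \<open>8 * s - 1\<close>.\<close>
  define b where "b d = (let k = d div 2 in if even d then 2 * s - k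
    else if k = 2 * s - 1 then 2 * s else if k = s - 1 then 6 * s else if k = 0 then 5 * s - 1
    else if s \<le> k then 6 * s - 2 - k else 6 * s - 1 - k)" for d
  have be: "b (2 * k) = 2 * s - k" for k
    using assms by (auto simp: b_def Let_def)
  have bt: "b (2 * (2 * s - 1) + 1) = 2 * s"
    using assms by (auto simp: b_def Let_def)
  have bm: "b (2 * (s - 1) + 1) = 6 * s"
    using assms by (auto simp: b_def Let_def)
  have b1: "b 1 = 5 * s - 1"
    using assms by (auto simp: b_def Let_def)
  have bh: "b (2 * k + 1) = 6 * s - 2 - k" if "s \<le> k" "k \<le> 2 * s - 2" for k
    using that assms by (auto simp: b_def Let_def)
  have bl: "b (2 * k + 1) = 6 * s - 1 - k" if "1 \<le> k" "k \<le> s - 2" for k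
    using that assms by (auto simp: b_def Let_def)
  have "skolem_starts (4 * s - 1) ({1..8 * s - 3} \<union> {8 * s - 1}) b"
  proof (rule skolem_startsI)
    fix v :: nat
    assume v: "1 \<le> v" "v \<le> (4 * s - 1 + 1) div 2"
    consider "1 \<le> v" "v \<le> 2 * s - 1" | "v = 2 * s"
      using v by fastforce
    then show "\<exists>d\<in>{1..4 * s - 1}. v = b d"
    proof cases
      case 1
      then show ?thesis using assms v be by (intro bexI[of _ "2 * (2 * s - v)"]) auto
    next
      case 2
      then show ?thesis using assms v bt by (intro bexI[of _ "2 * (2 * s - 1) + 1"]) auto
    qed
  next
    fix v :: nat
    assume v: "v \<in> {1..8 * s - 3} \<union> {8 * s - 1}" "(4 * s - 1 + 1) div 2 < v"
    \<comment> \<open>From left to right: ends of the even differences, starts of the large odd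
      ones, both places of \<open>1\<close>, starts of the small odd ones, the end of
      \<open>4 * s - 1\<close>, the start of \<open>2 * s - 1\<close>, ends of the small and of the
      large odd ones, the hook.\<close>
    consider "v \<le> 4 * s - 1"
      | "4 * s - 1 < v" "v \<le> 5 * s - 2"
      | "5 * s - 2 < v" "v \<le> 5 * s - 1"
      | "5 * s - 1 < v" "v \<le> 5 * s"
      | "5 * s < v" "v \<le> 6 * s - 2"
      | "6 * s - 2 < v" "v \<le> 6 * s - 1"
      | "6 * s - 1 < v" "v \<le> 6 * s"
      | "6 * s < v" "v \<le> 7 * s - 2"
      | "7 * s - 2 < v" "v \<le> 8 * s - 3"
      | "8 * s - 3 < v"
      by (meson not_less)
    then show "\<exists>d\<in>{1..4 * s - 1}. v = b d \<or> v = b d + d"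
    proof cases
      case 1
      then show ?thesis using assms v be by (intro bexI[of _ "2 * (v - 2 * s)"]) auto
    next
      case 2
      then show ?thesis using assms v bh[of "6 * s - 2 - v"]
        by (intro bexI[of _ "2 * (6 * s - 2 - v) + 1"]) auto
    next
      case 3
      then show ?thesis using assms v b1 by (intro bexI[of _ "1"]) auto
    next
      case 4
      then show ?thesis using assms v b1 by (intro bexI[of _ "1"]) auto
    next
      case 5
      then show ?thesis using assms v bl[of "6 * s - 1 - v"]
        by (intro bexI[of _ "2 * (6 * s - 1 - v) + 1"]) auto
    next
      case 6
      then show ?thesis using assms v bt by (intro bexI[of _ "2 * (2 * s - 1) + 1"]) auto
    next
      case 7
      then show ?thesis using assms v bm by (intro bexI[of _ "2 * (s - 1) + 1"]) auto
    next
      case 8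
      then show ?thesis using assms v bl[of "v - 6 * s"]
        by (intro bexI[of _ "2 * (v - 6 * s) + 1"]) auto
    next
      case 9
      then show ?thesis using assms v bh[of "v + 1 - 6 * s"]
        by (intro bexI[of _ "2 * (v + 1 - 6 * s) + 1"]) auto
    next
      case 10
      then show ?thesis using assms v bm by (intro bexI[of _ "2 * (s - 1) + 1"]) auto
    qed
  qed (use assms in auto)
  then show ?thesis by blast
qed

lemma skolem_starts_4s:
  assumes "s \<ge> 2"
  shows "\<exists>b. skolem_starts (4 * s) ({1..8 * s}) b"
proof -
  \<comment> \<open>The nest of even differences is now centred at \<open>2 * s + 1\<close>. The
    difference \<open>2 * s + 1\<close> leaves the large odd family and ends at
    \<open>7 * s + 2\<close>, between the places of \<open>1\<close> and the ends of that family, so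
    that no hook remains.\<close>
  define b where "b d = (let k = d div 2 in if even d then 2 * s + 1 - k
    else if k = 2 * s - 1 then 2 * s + 1 else if k = s then 5 * s + 1 else if k = s - 1 then 4 * s + 2
    else if k = 0 then 7 * s else if s \<le> k then 6 * s + 1 - k else 6 * s - k)" for d
  have be: "b (2 * k) = 2 * s + 1 - k" for k
    using assms by (auto simp: b_def Let_def)
  have bt: "b (2 * (2 * s - 1) + 1) = 2 * s + 1"
    using assms by (auto simp: b_def Let_def)
  have bs: "b (2 * s + 1) = 5 * s + 1"
    using assms by (auto simp: b_def Let_def)
  have bm: "b (2 * (s - 1) + 1) = 4 * s + 2"
    using assms by (auto simp: b_def Let_def)
  have b1: "b 1 = 7 * s"
    using assms by (auto simp: b_def Let_def)
  have bh: "b (2 * k + 1) = 6 * s + 1 - k" if "s + 1 \<le> k" "k \<le> 2 * s - 2" for k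
    using that assms by (auto simp: b_def Let_def)
  have bl: "b (2 * k + 1) = 6 * s - k" if "1 \<le> k" "k \<le> s - 2" for k
    using that assms by (auto simp: b_def Let_def)
  have "skolem_starts (4 * s) ({1..8 * s}) b"
  proof (rule skolem_startsI)
    fix v :: nat
    assume v: "1 \<le> v" "v \<le> (4 * s + 1) div 2"
    consider "1 \<le> v" "v \<le> 2 * s"
      using v by fastforce
    then show "\<exists>d\<in>{1..4 * s}. v = b d"
    proof cases
      case 1
      then show ?thesis using assms v be by (intro bexI[of _ "2 * (2 * s + 1 - v)"]) auto
    qed
  next
    fix v :: nat
    assume v: "v \<in> {1..8 * s}" "(4 * s + 1) div 2 < v"
    consider "v \<le> 2 * s + 1"
      | "2 * s + 1 < v" "v \<le> 4 * s + 1"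
      | "4 * s + 1 < v" "v \<le> 4 * s + 2"
      | "4 * s + 2 < v" "v \<le> 5 * s"
      | "5 * s < v" "v \<le> 5 * s + 1"
      | "5 * s + 1 < v" "v \<le> 6 * s - 1"
      | "6 * s - 1 < v" "v \<le> 6 * s"
      | "6 * s < v" "v \<le> 6 * s + 1"
      | "6 * s + 1 < v" "v \<le> 7 * s - 1"
      | "7 * s - 1 < v" "v \<le> 7 * s"
      | "7 * s < v" "v \<le> 7 * s + 1"
      | "7 * s + 1 < v" "v \<le> 7 * s + 2"
      | "7 * s + 2 < v"
      by (meson not_less)
    then show "\<exists>d\<in>{1..4 * s}. v = b d \<or> v = b d + d"
    proof cases
      case 1
      then show ?thesis using assms v bt by (intro bexI[of _ "2 * (2 * s - 1) + 1"]) auto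
    next
      case 2
      then show ?thesis using assms v be by (intro bexI[of _ "2 * (v - 2 * s - 1)"]) auto
    next
      case 3
      then show ?thesis using assms v bm by (intro bexI[of _ "2 * (s - 1) + 1"]) auto
    next
      case 4
      then show ?thesis using assms v bh[of "6 * s + 1 - v"]
        by (intro bexI[of _ "2 * (6 * s + 1 - v) + 1"]) auto
    next
      case 5
      then show ?thesis using assms v bs by (intro bexI[of _ "2 * s + 1"]) auto
    next
      case 6
      then show ?thesis using assms v bl[of "6 * s - v"]
        by (intro bexI[of _ "2 * (6 * s - v) + 1"]) auto
    next
      case 7
      then show ?thesis using assms v bt by (intro bexI[of _ "2 * (2 * s - 1) + 1"]) auto
    next
      case 8
      then show ?thesis using assms v bm by (intro bexI[of _ "2 * (s - 1) + 1"]) auto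
    next
      case 9
      then show ?thesis using assms v bl[of "v - 6 * s - 1"]
        by (intro bexI[of _ "2 * (v - 6 * s - 1) + 1"]) auto
    next
      case 10
      then show ?thesis using assms v b1 by (intro bexI[of _ "1"]) auto
    next
      case 11
      then show ?thesis using assms v b1 by (intro bexI[of _ "1"]) auto
    next
      case 12
      then show ?thesis using assms v bs by (intro bexI[of _ "2 * s + 1"]) auto
    next
      case 13
      then show ?thesis using assms v bh[of "v - 6 * s - 2"]
        by (intro bexI[of _ "2 * (v - 6 * s - 2) + 1"]) auto
    qed
  qed (use assms in auto)
  then show ?thesis by blast
qed

lemma skolem_starts_4s_plus_1:
  assumes "s \<ge> 2"
  shows "\<exists>b. skolem_starts (4 * s + 1) ({1..8 * s + 2}) b"
proof -
  \<comment> \<open>The centre goes to the new largest difference \<open>4 * s + 1\<close>, and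
    \<open>2 * s + 1\<close> is again an ordinary member of the large odd family.\<close>
  define b where "b d = (let k = d div 2 in if even d then 2 * s + 1 - k
    else if k = 2 * s then 2 * s + 1 else if k = s - 1 then 4 * s + 2
    else if k = 0 then 7 * s + 1 else if s \<le> k then 6 * s + 2 - k else 6 * s + 1 - k)" for d
  have be: "b (2 * k) = 2 * s + 1 - k" for k
    using assms by (auto simp: b_def Let_def)
  have bt: "b (4 * s + 1) = 2 * s + 1"
    using assms by (auto simp: b_def Let_def)
  have bm: "b (2 * (s - 1) + 1) = 4 * s + 2"
    using assms by (auto simp: b_def Let_def)
  have b1: "b 1 = 7 * s + 1"
    using assms by (auto simp: b_def Let_def)
  have bh: "b (2 * k + 1) = 6 * s + 2 - k" if "s \<le> k" "k \<le> 2 * s - 1" for k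
    using that assms by (auto simp: b_def Let_def)
  have bl: "b (2 * k + 1) = 6 * s + 1 - k" if "1 \<le> k" "k \<le> s - 2" for k
    using that assms by (auto simp: b_def Let_def)
  have "skolem_starts (4 * s + 1) ({1..8 * s + 2}) b"
  proof (rule skolem_startsI)
    fix v :: nat
    assume v: "1 \<le> v" "v \<le> (4 * s + 1 + 1) div 2"
    consider "1 \<le> v" "v \<le> 2 * s" | "v = 2 * s + 1"
      using v by fastforce
    then show "\<exists>d\<in>{1..4 * s + 1}. v = b d"
    proof cases
      case 1
      then show ?thesis using assms v be by (intro bexI[of _ "2 * (2 * s + 1 - v)"]) auto
    next
      case 2
      then show ?thesis using assms v bt by (intro bexI[of _ "4 * s + 1"]) auto
    qed
  next
    fix v :: nat
    assume v: "v \<in> {1..8 * s + 2}" "(4 * s + 1 + 1) div 2 < v"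
    consider "v \<le> 4 * s + 1"
      | "4 * s + 1 < v" "v \<le> 4 * s + 2"
      | "4 * s + 2 < v" "v \<le> 5 * s + 2"
      | "5 * s + 2 < v" "v \<le> 6 * s"
      | "6 * s < v" "v \<le> 6 * s + 1"
      | "6 * s + 1 < v" "v \<le> 6 * s + 2"
      | "6 * s + 2 < v" "v \<le> 7 * s"
      | "7 * s < v" "v \<le> 7 * s + 1"
      | "7 * s + 1 < v" "v \<le> 7 * s + 2"
      | "7 * s + 2 < v"
      by (meson not_less)
    then show "\<exists>d\<in>{1..4 * s + 1}. v = b d \<or> v = b d + d"
    proof cases
      case 1
      then show ?thesis using assms v be by (intro bexI[of _ "2 * (v - 2 * s - 1)"]) auto
    next
      case 2
      then show ?thesis using assms v bm by (intro bexI[of _ "2 * (s - 1) + 1"]) auto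
    next
      case 3
      then show ?thesis using assms v bh[of "6 * s + 2 - v"]
        by (intro bexI[of _ "2 * (6 * s + 2 - v) + 1"]) auto
    next
      case 4
      then show ?thesis using assms v bl[of "6 * s + 1 - v"]
        by (intro bexI[of _ "2 * (6 * s + 1 - v) + 1"]) auto
    next
      case 5
      then show ?thesis using assms v bm by (intro bexI[of _ "2 * (s - 1) + 1"]) auto
    next
      case 6
      then show ?thesis using assms v bt by (intro bexI[of _ "4 * s + 1"]) auto
    next
      case 7
      then show ?thesis using assms v bl[of "v - 6 * s - 2"]
        by (intro bexI[of _ "2 * (v - 6 * s - 2) + 1"]) auto
    next
      case 8
      then show ?thesis using assms v b1 by (intro bexI[of _ "1"]) auto
    next
      case 9
      then show ?thesis using assms v b1 by (intro bexI[of _ "1"]) auto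
    next
      case 10
      then show ?thesis using assms v bh[of "v - 6 * s - 3"]
        by (intro bexI[of _ "2 * (v - 6 * s - 3) + 1"]) auto
    qed
  qed (use assms in auto)
  then show ?thesis by blast
qed

lemma skolem_starts_4s_plus_2:
  assumes "s \<ge> 1"
  shows "\<exists>b. skolem_starts (4 * s + 2) ({1..8 * s + 3} \<union> {8 * s + 5}) b"
proof -
  \<comment> \<open>The largest even difference leaves the nest and runs from
    \<open>4 * s + 3\<close> to the hook \<open>8 * s + 5\<close>. The odd families are separated by
    \<open>2 * s + 1\<close>, which differs from \<open>1\<close> already for
    \<open>s = 1\<close>.\<close>
  define b where "b d = (let k = d div 2 in if d = 4 * s + 2 then 4 * s + 3
    else if even d then 2 * s + 1 - k
    else if k = 2 * s then 2 * s + 1 else if k = s then 4 * s + 2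
    else if k = 0 then 7 * s + 3 else if s \<le> k then 6 * s + 3 - k else 6 * s + 2 - k)" for d
  have bn: "b (4 * s + 2) = 4 * s + 3"
    using assms by (auto simp: b_def Let_def)
  have bt: "b (4 * s + 1) = 2 * s + 1"
    using assms by (auto simp: b_def Let_def)
  have bm: "b (2 * s + 1) = 4 * s + 2"
    using assms by (auto simp: b_def Let_def)
  have b1: "b 1 = 7 * s + 3"
    using assms by (auto simp: b_def Let_def)
  have be: "b (2 * k) = 2 * s + 1 - k" if "k \<le> 2 * s" for k
    using that assms by (auto simp: b_def Let_def)
  have bh: "b (2 * k + 1) = 6 * s + 3 - k" if "s + 1 \<le> k" "k \<le> 2 * s - 1" for k
    using that assms by (auto simp: b_def Let_def)
  have bl: "b (2 * k + 1) = 6 * s + 2 - k" if "1 \<le> k" "k \<le> s - 1" for k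
    using that assms by (auto simp: b_def Let_def)
  have "skolem_starts (4 * s + 2) ({1..8 * s + 3} \<union> {8 * s + 5}) b"
  proof (rule skolem_startsI)
    fix v :: nat
    assume v: "1 \<le> v" "v \<le> (4 * s + 2 + 1) div 2"
    consider "1 \<le> v" "v \<le> 2 * s" | "v = 2 * s + 1"
      using v by fastforce
    then show "\<exists>d\<in>{1..4 * s + 2}. v = b d"
    proof cases
      case 1
      then show ?thesis using assms v be[of "2 * s + 1 - v"]
        by (intro bexI[of _ "2 * (2 * s + 1 - v)"]) auto
    next
      case 2
      then show ?thesis using assms v bt by (intro bexI[of _ "4 * s + 1"]) auto
    qed
  next
    fix v :: nat
    assume v: "v \<in> {1..8 * s + 3} \<union> {8 * s + 5}" "(4 * s + 2 + 1) div 2 < v"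
    consider "v \<le> 4 * s + 1"
      | "4 * s + 1 < v" "v \<le> 4 * s + 2"
      | "4 * s + 2 < v" "v \<le> 4 * s + 3"
      | "4 * s + 3 < v" "v \<le> 5 * s + 2"
      | "5 * s + 2 < v" "v \<le> 6 * s + 1"
      | "6 * s + 1 < v" "v \<le> 6 * s + 2"
      | "6 * s + 2 < v" "v \<le> 6 * s + 3"
      | "6 * s + 3 < v" "v \<le> 7 * s + 2"
      | "7 * s + 2 < v" "v \<le> 7 * s + 3"
      | "7 * s + 3 < v" "v \<le> 7 * s + 4"
      | "7 * s + 4 < v" "v \<le> 8 * s + 3"
      | "8 * s + 3 < v"
      by (meson not_less)
    then show "\<exists>d\<in>{1..4 * s + 2}. v = b d \<or> v = b d + d"
    proof cases
      case 1
      then show ?thesis using assms v be[of "v - 2 * s - 1"]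
        by (intro bexI[of _ "2 * (v - 2 * s - 1)"]) auto
    next
      case 2
      then show ?thesis using assms v bm by (intro bexI[of _ "2 * s + 1"]) auto
    next
      case 3
      then show ?thesis using assms v bn by (intro bexI[of _ "4 * s + 2"]) auto
    next
      case 4
      then show ?thesis using assms v bh[of "6 * s + 3 - v"]
        by (intro bexI[of _ "2 * (6 * s + 3 - v) + 1"]) auto
    next
      case 5
      then show ?thesis using assms v bl[of "6 * s + 2 - v"]
        by (intro bexI[of _ "2 * (6 * s + 2 - v) + 1"]) auto
    next
      case 6
      then show ?thesis using assms v bt by (intro bexI[of _ "4 * s + 1"]) auto
    next
      case 7
      then show ?thesis using assms v bm by (intro bexI[of _ "2 * s + 1"]) auto
    next
      case 8
      then show ?thesis using assms v bl[of "v - 6 * s - 3"]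
        by (intro bexI[of _ "2 * (v - 6 * s - 3) + 1"]) auto
    next
      case 9
      then show ?thesis using assms v b1 by (intro bexI[of _ "1"]) auto
    next
      case 10
      then show ?thesis using assms v b1 by (intro bexI[of _ "1"]) auto
    next
      case 11
      then show ?thesis using assms v bh[of "v - 6 * s - 4"]
        by (intro bexI[of _ "2 * (v - 6 * s - 4) + 1"]) auto
    next
      case 12
      then show ?thesis using assms v bn by (intro bexI[of _ "4 * s + 2"]) auto
    qed
  qed (use assms in auto)
  then show ?thesis by blast
qed

text \<open>For \<open>s = 1\<close> the other three constructions would assign two places to the
  difference \<open>2 * s - 1 = 1\<close>, so orders 3, 4 and 5 get their own sequences, here
  \<open>3 1 1 3 2 _ 2\<close>. The leading \<open>0\<close> makes entry \<open>d\<close> of the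
  list the start of \<open>d\<close>.\<close>

lemma skolem_starts_3: "skolem_starts 3 ({1..5} \<union> {7}) (\<lambda>d. [0, 2, 5, 1] ! d)"
proof -
  have "{1..3::nat} = {1, 2, 3}" "{1..5::nat} = {1, 2, 3, 4, 5}" "{1..(3 + 1) div 2::nat} = {1, 2}"
    by auto
  then show ?thesis unfolding skolem_starts_def by (simp only:) simp
qed

lemma skolem_starts_4: "skolem_starts 4 {1..8} (\<lambda>d. [0, 7, 2, 3, 1] ! d)"
proof -
  have "{1..4::nat} = {1, 2, 3, 4}" "{1..8::nat} = {1, 2, 3, 4, 5, 6, 7, 8}"
    "{1..(4 + 1) div 2::nat} = {1, 2}"
    by auto
  then show ?thesis unfolding skolem_starts_def by (simp only:) simp
qed

lemma skolem_starts_5: "skolem_starts 5 {1..10} (\<lambda>d. [0, 8, 3, 1, 6, 2] ! d)"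
proof -
  have "{1..5::nat} = {1, 2, 3, 4, 5}" "{1..10::nat} = {1, 2, 3, 4, 5, 6, 7, 8, 9, 10}"
    "{1..3::nat} = {1, 2, 3}"
    by (simp_all add: numeral_eq_Suc atLeastAtMostSuc_conv insert_commute)
  then show ?thesis unfolding skolem_starts_def by (simp only:) simp
qed

lemma ex_skolem_starts:
  assumes "n \<ge> 3"
  shows "(\<exists>b. skolem_starts n {1..2 * n} b) \<or>
    (\<exists>b. skolem_starts n ({1..2 * n - 1} \<union> {2 * n + 1}) b)"
proof -
  define s where "s = n div 4"
  consider "n = 3" | "n = 4" | "n = 5" | "s \<ge> 2" "n = 4 * s" | "s \<ge> 2" "n = 4 * s + 1"
    | "s \<ge> 1" "n = 4 * s + 2" | "s \<ge> 1" "n = 4 * (s + 1) - 1"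
    unfolding s_def using assms by fastforce
  then show ?thesis
  proof cases
    case 1
    then show ?thesis using skolem_starts_3 by auto
  next
    case 2
    then show ?thesis using skolem_starts_4 by auto
  next
    case 3
    then show ?thesis using skolem_starts_5 by auto
  next
    case 4
    then show ?thesis using skolem_starts_4s[of s] by simp
  next
    case 5
    then show ?thesis using skolem_starts_4s_plus_1[of s] by (simp add: algebra_simps)
  next
    case 6
    have eq: "2 * n - 1 = 8 * s + 3" "2 * n + 1 = 8 * s + 5" using 6 by auto
    show ?thesis
      using skolem_starts_4s_plus_2[OF 6(1)] unfolding eq[symmetric] 6(2)[symmetric] ..
  next
    case 7
    have eq: "2 * n - 1 = 8 * (s + 1) - 3" "2 * n + 1 = 8 * (s + 1) - 1" and "2 \<le> s + 1"
      using 7 by auto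
    then show ?thesis
      using skolem_starts_4s_minus_1[of "s + 1"] unfolding eq[symmetric] 7(2)[symmetric] by blast
  qed
qed

section \<open>Pairing the differences\<close>

text \<open>The members of \<open>{a + 1..a + 2 * h}\<close> are paired by letting the smaller one run upwards in steps
  of \<open>1\<close> and the larger one downwards in steps of \<open>2\<close>, through one parity class after the other; the
  sums then decrease in steps of \<open>1\<close> along each class. The smallest sum exceeds \<open>n\<close> if and only if
  \<open>t + h div 2 \<le> 2 * a\<close>, and \<open>a \<le> t\<close> keeps the pairs within \<open>{1..n}\<close>. For \<open>t = h = 2\<close> the
  largest sum is too big and other pairs are needed.\<close>

lemma hexagon_pairing:
  fixes t h :: nat
  defines "n \<equiv> t + 2 * h"
  assumes "h \<ge> 1" and "h \<le> 2 * t + 1"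
  shows "\<exists>p q. inj_on p {..<h} \<and> inj_on q {..<h} \<and> p ` {..<h} \<inter> q ` {..<h} = {} \<and>
    p ` {..<h} \<union> q ` {..<h} \<subseteq> {1..n} \<and> inj_on (\<lambda>k. p k + q k) {..<h} \<and>
    (\<lambda>k. p k + q k) ` {..<h} \<subseteq> {n + 1..n + (n + 1) div 2}"
proof (cases "t = 2 \<and> h = 2")
  case True
  then have "{..<h} = {0, 1}" and "n = 6" unfolding n_def by auto
  \<comment> \<open>The pairs are 3, 4 and 2, 6 with sums 7 and 8. The general recipe would give 3,
    5 and 4, 6, and the sum 10 exceeds 9.\<close>
  then show ?thesis
    by (intro exI[of _ "\<lambda>k. 3 - k"] exI[of _ "\<lambda>k. 4 + 2 * k"]) simp
next
  case False
  define r where "r = h div 2"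
  \<comment> \<open>The least \<open>a\<close> with \<open>t + r \<le> 2 * a\<close>. From
    \<open>h \<le> 2 * t + 1\<close> follows \<open>r \<le> t\<close>, hence
    \<open>a \<le> t\<close>.\<close>
  define a where "a = (t + r + 1) div 2"
  define p where "p k = a + k + 1" for k
  define q where "q k = (if k < r then a + 2 * h - 1 - 2 * k else a + 2 * h + 2 * r - 2 * k)" for k
  have r: "2 * r \<le> h" "h \<le> 2 * r + 1"
    unfolding r_def by linarith+
  have a: "t + r \<le> 2 * a" "2 * a \<le> t + r + 1"
    unfolding a_def by linarith+
  \<comment> \<open>Sums of the first class are at most \<open>2 * a + 2 * h\<close>, those of the
    second class are larger, so the classes cannot collide.\<close>
  have sum: "p k + q k = (if k < r then 2 * a + 2 * h - k else 2 * a + 2 * h + 2 * r + 1 - k)"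
    if "k < h" for k
    using that r unfolding p_def q_def by auto
  have "inj_on p {..<h}"
    by (auto simp: inj_on_def p_def)
  moreover have "inj_on q {..<h}"
  proof (rule inj_onI)
    fix k l
    assume kl: "k \<in> {..<h}" "l \<in> {..<h}" and eq: "q k = q l"
    \<comment> \<open>The classes differ by the odd offset \<open>2 * r + 1\<close>, so equal values
      across them would contradict parity.\<close>
    have q: "q j + 2 * j + 1 = a + 2 * h + (if j < r then 0 else 2 * r + 1)" if "j < h" for j
      using that r unfolding q_def by auto
    have "2 * k + (if l < r then 0 else 2 * r + 1) = 2 * l + (if k < r then 0 else 2 * r + 1)"
      using q[of k] q[of l] kl eq by simp
    then show "k = l" by (simp split: if_splits) presburger+
  qed
  moreover have "p ` {..<h} \<inter> q ` {..<h} = {}"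
  proof -
    have "p k < q l" if "k < h" "l < h" for k l
      using that r unfolding p_def q_def by auto
    then show ?thesis by fastforce
  qed
  moreover have "p ` {..<h} \<union> q ` {..<h} \<subseteq> {1..n}"
    using a r assms unfolding p_def q_def n_def by (auto split: if_splits)
  moreover have "inj_on (\<lambda>k. p k + q k) {..<h}"
    unfolding inj_on_def using r by (auto simp: sum split: if_splits)
  moreover have "p k + q k \<in> {n + 1..n + (n + 1) div 2}" if "k < h" for k
  proof -
    \<comment> \<open>The largest sum, at \<open>k = r\<close>, is
      \<open>2 * a + 2 * h + r + 1\<close>. As \<open>2 * a \<le> t + r + 1\<close>, it suffices
      that \<open>2 * r + 2 \<le> (n + 1) div 2\<close>, which holds for \<open>t \<ge> 4\<close>
      because \<open>4 * r \<le> 2 * h\<close>. Smaller \<open>t\<close> leave finitely many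
      \<open>h\<close>.\<close>
    have "2 * a + r + 1 \<le> t + (n + 1) div 2"
    proof (cases "t < 4")
      case True
      then have "t \<in> {0, 1, 2, 3}" by auto
      moreover have "h \<in> {1, 2, 3, 4, 5, 6, 7}" using True assms by auto
      ultimately show ?thesis
        using False assms(3) unfolding a_def r_def n_def by (elim insertE emptyE) simp_all
    next
      case False
      then show ?thesis using a r unfolding n_def by linarith
    qed
    then show ?thesis
      using that sum[OF that] a r assms unfolding n_def by auto
  qed
  ultimately show ?thesis by blast
qed

section \<open>Labelling the graph\<close>

text \<open>Two images of an \<open>n\<close>-element set cover \<open>2 * n\<close> positions, so
  neither loses an element and they cannot overlap.\<close>

lemma skolem_starts_bijective:
  assumes "skolem_starts n V b" and "card V = 2 * n" and "finite V"
  shows "inj_on (\<lambda>d. b d + d) {1..n}" "b ` {1..n} \<inter> (\<lambda>d. b d + d) ` {1..n} = {}"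
    "b ` {1..n} \<union> (\<lambda>d. b d + d) ` {1..n} = V"
proof -
  let ?A = "b ` {1..n}" and ?B = "(\<lambda>d. b d + d) ` {1..n}"
  have V: "V \<subseteq> ?A \<union> ?B"
    using assms(1) by (simp add: skolem_starts_def)
  have A: "card ?A \<le> n" and B: "card ?B \<le> n"
    using card_image_le[of "{1..n}" b] card_image_le[of "{1..n}" "\<lambda>d. b d + d"] by auto
  have Un: "card ?A + card ?B = card (?A \<union> ?B) + card (?A \<inter> ?B)"
    by (rule card_Un_Int) auto
  have le: "2 * n \<le> card (?A \<union> ?B)"
    using card_mono[OF _ V] assms(2) by simp
  have "card ?B = card {1..n}"
    using A B Un le by simp
  then show "inj_on (\<lambda>d. b d + d) {1..n}"
    by (intro eq_card_imp_inj_on) auto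
  have "card (?A \<inter> ?B) = 0"
    using A B Un le by linarith
  then show "?A \<inter> ?B = {}"
    using card_0_eq[of "?A \<inter> ?B"] by blast
  have "card (?A \<union> ?B) \<le> card V"
    using A B Un assms(2) by simp
  then show "?A \<union> ?B = V"
    using card_seteq[OF _ V] by simp
qed

text \<open>Reduces bijectivity to attaining every label: a surjection between finite sets of equal
  size is injective.\<close>

lemma ex_bijective_edge_labelling:
  assumes "simple_graph G" and "finite L" and "card L = card (edges G)"
    and L: "\<And>l. l \<in> L \<Longrightarrow> \<exists>u v. {u, v} \<in> edges G \<and> \<bar>f u - f v\<bar> = l"
  shows "\<exists>g. induced_edge_labelling G f g \<and> bij_betw g (edges G) L"
proof -
  \<comment> \<open>Depends on the edge as a set only, so no orientation has to be chosen.\<close>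
  define g where "g e = Max (f ` e) - Min (f ` e)" for e
  have g: "g {u, v} = \<bar>f u - f v\<bar>" for u v
    by (simp add: g_def max_def min_def)
  have fin: "finite (edges G)"
    by (rule finite_edges) fact
  have sub: "L \<subseteq> g ` edges G"
    using L g by (metis image_eqI subsetI)
  have "card (g ` edges G) \<le> card L"
    using card_image_le[OF fin] assms(3) by simp
  then have L_eq: "L = g ` edges G"
    using card_seteq[OF _ sub] fin by simp
  then have "inj_on g (edges G)"
    using assms(3) fin by (intro eq_card_imp_inj_on) auto
  then show ?thesis
    using L_eq g unfolding bij_betw_def induced_edge_labelling_def by blast
qed

section \<open>Vertices and edges of the combined graph\<close>

lemma verts_C3_C6_cases:
  assumes "v \<in> verts (C3_C6 t h)"
  obtains "v = None"
  | k where "k < t" "v = Some (Inl (k, 1))" | k where "k < t" "v = Some (Inl (k, 2))"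
  | k where "k < h" "v = Some (Inr (k, 1))" | k where "k < h" "v = Some (Inr (k, 2))"
  | k where "k < h" "v = Some (Inr (k, 3))" | k where "k < h" "v = Some (Inr (k, 4))"
  | k where "k < h" "v = Some (Inr (k, 5))"
proof -
  consider k j where "k < t" "j < 3" "v = map_option Inl (cycle_vertex k j)"
    | k j where "k < h" "j < 6" "v = map_option Inr (cycle_vertex k j)"
    using assms unfolding C3_C6_def identify_centres_def cycles_at_centre_def by auto
  then show thesis
  proof cases
    case 1
    have "j \<in> {0, 1, 2}" using 1(2) by auto
    then show thesis using 1 that by (auto simp: cycle_vertex_def)
  next
    case 2
    have "j \<in> {0, 1, 2, 3, 4, 5}" using 2(2) by auto
    then show thesis using 2 that by (auto simp: cycle_vertex_def)
  qed
qed

lemma triangle_edges_C3_C6: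
  assumes "k < t"
  shows "{None, Some (Inl (k, 1))} \<in> edges (C3_C6 t h)"
    "{Some (Inl (k, 1)), Some (Inl (k, 2))} \<in> edges (C3_C6 t h)"
    "{Some (Inl (k, 2)), None} \<in> edges (C3_C6 t h)"
proof -
  have e: "{map_option Inl (cycle_vertex k j), map_option Inl (cycle_vertex k ((j + 1) mod 3))}
      \<in> edges (C3_C6 t h)" if "j < 3" for j
  proof -
    have "{cycle_vertex k j, cycle_vertex k ((j + 1) mod 3)} \<in> edges (cycles_at_centre 3 t)"
      using assms that unfolding cycles_at_centre_def by auto
    then have "map_option Inl ` {cycle_vertex k j, cycle_vertex k ((j + 1) mod 3)}
        \<in> edges (C3_C6 t h)"
      unfolding C3_C6_def identify_centres_def snd_conv by blast
    then show ?thesis by simp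
  qed
  show "{None, Some (Inl (k, 1))} \<in> edges (C3_C6 t h)"
    "{Some (Inl (k, 1)), Some (Inl (k, 2))} \<in> edges (C3_C6 t h)"
    "{Some (Inl (k, 2)), None} \<in> edges (C3_C6 t h)"
    using e[of 0] e[of 1] e[of 2] by (simp_all add: cycle_vertex_def numeral_2_eq_2)
qed

lemma hexagon_edges_C3_C6:
  assumes "k < h"
  shows "{None, Some (Inr (k, 1))} \<in> edges (C3_C6 t h)"
    "{Some (Inr (k, 1)), Some (Inr (k, 2))} \<in> edges (C3_C6 t h)"
    "{Some (Inr (k, 2)), Some (Inr (k, 3))} \<in> edges (C3_C6 t h)"
    "{Some (Inr (k, 3)), Some (Inr (k, 4))} \<in> edges (C3_C6 t h)"
    "{Some (Inr (k, 4)), Some (Inr (k, 5))} \<in> edges (C3_C6 t h)"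
    "{Some (Inr (k, 5)), None} \<in> edges (C3_C6 t h)"
proof -
  have e: "{map_option Inr (cycle_vertex k j), map_option Inr (cycle_vertex k j')}
      \<in> edges (C3_C6 t h)" if "j < 6" "j' = (j + 1) mod 6" for j j'
  proof -
    have "{cycle_vertex k j, cycle_vertex k j'} \<in> edges (cycles_at_centre 6 h)"
      using assms that unfolding cycles_at_centre_def by auto
    then have "map_option Inr ` {cycle_vertex k j, cycle_vertex k j'} \<in> edges (C3_C6 t h)"
      unfolding C3_C6_def identify_centres_def snd_conv by blast
    then show ?thesis by simp
  qed
  show "{None, Some (Inr (k, 1))} \<in> edges (C3_C6 t h)"
    "{Some (Inr (k, 1)), Some (Inr (k, 2))} \<in> edges (C3_C6 t h)"
    "{Some (Inr (k, 2)), Some (Inr (k, 3))} \<in> edges (C3_C6 t h)"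
    "{Some (Inr (k, 3)), Some (Inr (k, 4))} \<in> edges (C3_C6 t h)"
    "{Some (Inr (k, 4)), Some (Inr (k, 5))} \<in> edges (C3_C6 t h)"
    "{Some (Inr (k, 5)), None} \<in> edges (C3_C6 t h)"
    using e[of 0 1] e[of 1 2] e[of 2 3] e[of 3 4] e[of 4 5] e[of 5 0]
    by (simp_all add: cycle_vertex_def)
qed

text \<open>Treats perfect and hooked sequences alike: \<open>V\<close> is the set of positions and
  \<open>w\<close> bounds them. Attaining each edge label is enough, since bijectivity follows by
  counting.\<close>

lemma C3_C6_labelling_of_skolem_starts:
  fixes t h :: nat
  defines "n \<equiv> t + 2 * h"
  assumes h: "h \<ge> 1" "h \<le> 2 * t + 1"
    and b: "skolem_starts n V b" and V: "card V = 2 * n" "V \<subseteq> {1..w}"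
  obtains f where "inj_on f (verts (C3_C6 t h))"
    and "f ` verts (C3_C6 t h) \<subseteq> {0..int (n + w)}"
    and "\<And>l. l \<in> {1..n} \<union> (+) n ` V \<Longrightarrow>
      \<exists>u v. {u, v} \<in> edges (C3_C6 t h) \<and> \<bar>f u - f v\<bar> = int l"
proof -
  have "finite V" using V(2) by (rule finite_subset) simp
  note bij = skolem_starts_bijective[OF b V(1) this]
  obtain p q where pq: "inj_on p {..<h}" "inj_on q {..<h}" "p ` {..<h} \<inter> q ` {..<h} = {}"
    "p ` {..<h} \<union> q ` {..<h} \<subseteq> {1..n}" "inj_on (\<lambda>k. p k + q k) {..<h}"
    "(\<lambda>k. p k + q k) ` {..<h} \<subseteq> {n + 1..n + (n + 1) div 2}"
    using hexagon_pairing[OF h, folded n_def] by (elim exE conjE) (rule that)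
  \<comment> \<open>The differences left for the triangles; there are \<open>n - 2 * h = t\<close>
    of them.\<close>
  define T where "T = {1..n} - (p ` {..<h} \<union> q ` {..<h})"
  have "card (p ` {..<h} \<union> q ` {..<h}) = 2 * h"
    using pq by (simp add: card_Un_disjoint card_image)
  then have "card T = card {..<t}"
    unfolding T_def using pq(4) by (simp add: card_Diff_subset n_def)
  then obtain r where r: "bij_betw r {..<t} T"
    using finite_same_card_bij[of "{..<t}" T] by (auto simp: T_def)
  \<comment> \<open>The largest member of the triple \<open>d\<close>, \<open>n + b d\<close>,
    \<open>n + b d + d\<close>.\<close>
  define c where "c d = n + b d + d" for d
  define f :: "(nat \<times> nat + nat \<times> nat) option \<Rightarrow> int" where
    "f v = int (case v of None \<Rightarrow> 0
      | Some (Inl (k, j)) \<Rightarrow> (if j = 1 then r k else c (r k))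
      | Some (Inr (k, j)) \<Rightarrow> (if j = 1 then c (p k) else if j = 2 then p k
          else if j = 3 then p k + q k else if j = 4 then q k else c (q k)))" for v
  have rng: "\<And>k. k < t \<Longrightarrow> r k \<in> {1..n}" "\<And>k. k < h \<Longrightarrow> p k \<in> {1..n}" "\<And>k. k < h \<Longrightarrow> q k \<in> {1..n}"
    using r pq(4) by (auto simp: T_def bij_betw_def)
  have ne: "p k \<noteq> q l" "q l \<noteq> p k" if "k < h" "l < h" for k l
    using that pq(3) by auto
  have ne_r: "p k \<noteq> r l" "q k \<noteq> r l" "r l \<noteq> p k" "r l \<noteq> q k" if "k < h" "l < t" for k l
    using that r by (auto simp: T_def bij_betw_def)
  have inj: "r k = r l \<longleftrightarrow> k = l" if "k < t" "l < t" for k l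
    using that r by (auto simp: bij_betw_def inj_on_def)
  have inj_pq: "p k = p l \<longleftrightarrow> k = l" "q k = q l \<longleftrightarrow> k = l" "p k + q k = p l + q l \<longleftrightarrow> k = l"
    if "k < h" "l < h" for k l
    using that pq(1,2,5) by (auto simp: inj_on_def)
  have c_inj: "c d = c e \<longleftrightarrow> d = e" if "d \<in> {1..n}" "e \<in> {1..n}" for d e
    using that bij(1) unfolding c_def inj_on_def by (metis add.assoc add_left_cancel)
  have c_gt: "c d > n" "c d \<le> n + w" if "d \<in> {1..n}" for d
  proof -
    have "b d + d \<in> V" using bij(3) that by blast
    then show "c d > n" "c d \<le> n + w" using V(2) by (auto simp: c_def)
  qed
  \<comment> \<open>Here the first half of the sequence matters: its positions are left endpoints,
    so the sum is the middle member of some triple.\<close>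
  have sum: "p k + q k \<in> (+) n ` b ` {1..n}" if "k < h" for k
  proof -
    have "p k + q k \<in> {n + 1..n + (n + 1) div 2}" using pq(6) that by blast
    then have "p k + q k - n \<in> {1..(n + 1) div 2}" "p k + q k = n + (p k + q k - n)" by auto
    then show ?thesis using b unfolding skolem_starts_def by blast
  qed
  have sum_gt: "p k + q k > n" "p k + q k \<le> n + w" if "k < h" for k
    using sum[OF that] bij(3) V(2) by fastforce+
  \<comment> \<open>A middle member cannot equal a largest member, because left and right endpoints
    occupy disjoint positions.\<close>
  have sum_ne: "p k + q k \<noteq> c d" if "k < h" "d \<in> {1..n}" for k d
  proof
    assume eq: "p k + q k = c d"
    obtain e where "e \<in> {1..n}" "p k + q k = n + b e" using sum[OF \<open>k < h\<close>] by blast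
    then have "b e = b d + d" using eq by (simp add: c_def)
    then show False using bij(2) that(2) \<open>e \<in> {1..n}\<close> by blast
  qed
  have c_ne: "r k \<noteq> c d" "c d \<noteq> r k" if "k < t" "d \<in> {1..n}" for k d
    using rng(1)[OF that(1)] c_gt(1)[OF that(2)] by auto
  have c_ne': "p k \<noteq> c d" "c d \<noteq> p k" "q k \<noteq> c d" "c d \<noteq> q k" if "k < h" "d \<in> {1..n}" for k d
    using rng(2,3)[OF that(1)] c_gt(1)[OF that(2)] by auto
  have s_ne: "r k \<noteq> p l + q l" "p l + q l \<noteq> r k" if "k < t" "l < h" for k l
    using rng(1)[OF that(1)] sum_gt(1)[OF that(2)] by auto
  have s_ne': "p k \<noteq> p l + q l" "p l + q l \<noteq> p k" "q k \<noteq> p l + q l" "p l + q l \<noteq> q k"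
    if "k < h" "l < h" for k l
    using rng(2,3)[OF that(1)] sum_gt(1)[OF that(2)] by auto
  have pos: "\<And>k. k < t \<Longrightarrow> 0 < r k" "\<And>k. k < h \<Longrightarrow> 0 < p k" "\<And>k. k < h \<Longrightarrow> 0 < q k"
    "\<And>d. d \<in> {1..n} \<Longrightarrow> 0 < c d"
    using rng c_gt(1) by fastforce+
  have f_inj: "inj_on f (verts (C3_C6 t h))"
  proof (rule inj_onI)
    fix u v
    assume uv: "u \<in> verts (C3_C6 t h)" "v \<in> verts (C3_C6 t h)" "f u = f v"
    define I where "I = {1..n}"
    note facts = rng ne ne_r inj inj_pq c_inj sum_ne sum_ne[symmetric] c_ne c_ne' s_ne s_ne' pos
      pos[THEN gr_implies_not0]
    \<comment> \<open>Nonzero labels up to \<open>n\<close> are separated by the disjoint ranges of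
      \<open>r\<close>, \<open>p\<close> and \<open>q\<close>; labels above \<open>n\<close> are
      values of \<open>c\<close> or sums \<open>p k + q k\<close>.\<close>
    from uv show "u = v"
      by (elim verts_C3_C6_cases; hypsubst; simp add: f_def facts[folded I_def] del: of_nat_add)
  qed
  have f_range: "f v \<in> {0..int (n + w)}" if "v \<in> verts (C3_C6 t h)" for v
  proof -
    define I where "I = {1..n}"
    have "d \<le> n + w" "c d \<le> n + w" if "d \<in> I" for d
      using that c_gt by (auto simp: I_def)
    then show ?thesis
      using that
      by (elim verts_C3_C6_cases)
        (simp_all add: f_def rng[folded I_def] sum_gt del: of_nat_add)
  qed
  have f_edges: "\<exists>u v. {u, v} \<in> edges (C3_C6 t h) \<and> \<bar>f u - f v\<bar> = int l"
    if l: "l \<in> {1..n} \<union> (+) n ` V" for l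
  proof -
    obtain d where d: "d \<in> {1..n}" "l = d \<or> l = n + b d \<or> l = c d"
      using l bij(3) unfolding c_def by (auto simp: add.assoc)
    have "d \<in> r ` {..<t} \<or> d \<in> p ` {..<h} \<or> d \<in> q ` {..<h}"
      using d(1) r unfolding bij_betw_def T_def by blast
    then consider k where "k < t" "d = r k" | k where "k < h" "d = p k" | k where "k < h" "d = q k"
      by blast
    then show ?thesis
    proof cases
      case 1
      have "\<bar>f None - f (Some (Inl (k, 1)))\<bar> = int d"
        "\<bar>f (Some (Inl (k, 1))) - f (Some (Inl (k, 2)))\<bar> = int (n + b d)"
        "\<bar>f (Some (Inl (k, 2))) - f None\<bar> = int (c d)"
        using 1 by (simp_all add: f_def c_def)
      then show ?thesis using d(2) triangle_edges_C3_C6[OF 1(1)] by metis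
    next
      case 2
      \<comment> \<open>At the vertex labelled \<open>p k + q k\<close> the differences cross over:
        the edge towards \<open>q k\<close> has label \<open>p k\<close>, and conversely.\<close>
      have "\<bar>f (Some (Inr (k, 3))) - f (Some (Inr (k, 4)))\<bar> = int d"
        "\<bar>f (Some (Inr (k, 1))) - f (Some (Inr (k, 2)))\<bar> = int (n + b d)"
        "\<bar>f None - f (Some (Inr (k, 1)))\<bar> = int (c d)"
        using 2 by (simp_all add: f_def c_def)
      then show ?thesis using d(2) hexagon_edges_C3_C6[OF 2(1)] by metis
    next
      case 3
      have "\<bar>f (Some (Inr (k, 2))) - f (Some (Inr (k, 3)))\<bar> = int d"
        "\<bar>f (Some (Inr (k, 4))) - f (Some (Inr (k, 5)))\<bar> = int (n + b d)"
        "\<bar>f (Some (Inr (k, 5))) - f None\<bar> = int (c d)"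
        using 3 by (simp_all add: f_def c_def)
      then show ?thesis using d(2) hexagon_edges_C3_C6[OF 3(1)] by metis
    qed
  qed
  show thesis
    by (rule that[OF f_inj image_subsetI[OF f_range] f_edges])
qed

theorem theorem6p3:
  fixes t h :: nat
  assumes "t \<ge> 1" and "h \<ge> 1" and "h \<le> 2 * t + 1"
  shows "graceful (C3_C6 t h) \<or> near_graceful (C3_C6 t h)"
proof -
  let ?G = "C3_C6 t h"
  define n where "n = t + 2 * h"
  have n: "n \<ge> 3" using assms by (simp add: n_def)
  have m: "card (edges ?G) = 3 * n"
    by (simp add: card_edges_C3_C6 n_def)
  consider b where "skolem_starts n {1..2 * n} b"
    | b where "skolem_starts n ({1..2 * n - 1} \<union> {2 * n + 1}) b"
    using ex_skolem_starts[OF n] by blast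
  then show ?thesis
  proof cases
    case (1 b)
    \<comment> \<open>The largest position \<open>2 * n\<close> bounds the vertex labels by
      \<open>3 * n\<close>, the number of edges.\<close>
    obtain f where f: "inj_on f (verts ?G)" "f ` verts ?G \<subseteq> {0..int (n + 2 * n)}"
      and lab: "\<And>l. l \<in> {1..n} \<union> (+) n ` {1..2 * n} \<Longrightarrow>
        \<exists>u v. {u, v} \<in> edges ?G \<and> \<bar>f u - f v\<bar> = int l"
      by (rule C3_C6_labelling_of_skolem_starts[OF assms(2,3), of "{1..2 * n}" b "2 * n"])
        (use 1 in \<open>auto simp: n_def\<close>)
    have "\<exists>g. induced_edge_labelling ?G f g \<and> bij_betw g (edges ?G) {1..int (3 * n)}"
    proof (rule ex_bijective_edge_labelling[OF simple_graph_C3_C6])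
      fix l assume l: "l \<in> {1..int (3 * n)}"
      have "nat l \<in> {1..n} \<union> (+) n ` {1..2 * n}"
        using l by (auto simp: image_iff intro!: bexI[of _ "nat l - n"])
      then show "\<exists>u v. {u, v} \<in> edges ?G \<and> \<bar>f u - f v\<bar> = l"
        using lab[of "nat l"] l by simp
    qed (simp_all add: m)
    then have "graceful_labelling ?G f"
      using f unfolding graceful_labelling_def by (simp add: m)
    then show ?thesis unfolding graceful_def by blast
  next
    case (2 b)
    let ?V = "{1..2 * n - 1} \<union> {2 * n + 1}" and ?L = "{1..int (3 * n) - 1} \<union> {int (3 * n) + 1}"
    have "card ?V = 2 * n" using n by simp
    \<comment> \<open>The hook at \<open>2 * n + 1\<close> yields the edge label
      \<open>3 * n + 1\<close> in place of \<open>3 * n\<close>; the bound on vertex labels also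
      grows by one.\<close>
    obtain f where f: "inj_on f (verts ?G)" "f ` verts ?G \<subseteq> {0..int (n + (2 * n + 1))}"
      and lab: "\<And>l. l \<in> {1..n} \<union> (+) n ` ?V \<Longrightarrow>
        \<exists>u v. {u, v} \<in> edges ?G \<and> \<bar>f u - f v\<bar> = int l"
      by (rule C3_C6_labelling_of_skolem_starts[OF assms(2,3), of ?V b "2 * n + 1"])
        (use 2 \<open>card ?V = 2 * n\<close> in \<open>auto simp: n_def\<close>)
    have "\<exists>g. induced_edge_labelling ?G f g \<and> bij_betw g (edges ?G) ?L"
    proof (rule ex_bijective_edge_labelling[OF simple_graph_C3_C6])
      fix l assume l: "l \<in> ?L"
      then have "nat l \<in> {1..n} \<or> nat l - n \<in> ?V \<and> nat l = n + (nat l - n)"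
        using n by auto
      then have "nat l \<in> {1..n} \<union> (+) n ` ?V" by blast
      then show "\<exists>u v. {u, v} \<in> edges ?G \<and> \<bar>f u - f v\<bar> = l"
        using lab[of "nat l"] l by (cases "l \<ge> 0") auto
    qed (use n in \<open>simp_all add: m\<close>)
    then have "near_graceful_labelling ?G f"
      using f unfolding near_graceful_labelling_def Let_def m by (simp add: add_ac) blast
    then show ?thesis unfolding near_graceful_def by blast
  qed
qed

end
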